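(* Let $(A,[\cdot,\cdot],\sigma)$ be a finite-dimensional multiplicative Hom-Lie algebra over a field $\mathbb{F}$. Then $(A,[\cdot,\cdot],\sigma)$ is simple (as a Hom-Lie algebra) if and only if it is not abelian and the anticommutative algebra $(A,[\cdot,\cdot])$ has no ideals other than $0$ and $A$.
   Context: An anticommutative algebra is a vector space $A$ with a bilinear product $[\cdot,\cdot]$ satisfying $[x,x]=0$ for all $x$; it is abelian if the product is zero; an ideal is a subspace $I$ with $[I,A]\subset I$. A Hom-Lie algebra is a triple $(A,[\cdot,\cdot],\sigma)$ with $A$ an anticommutative algebra and $\sigma:A\to A$ linear with $[\sigma(x),[y,z]]+[\sigma(y),[z,x]]+[\sigma(z),[x,y]]=0$ for all $x,y,z\in A$; it is multiplicative if $\sigma([x,y])=[\sigma(x),\sigma(y)]$ for all $x,y$. A Hom-ideal is an ideal $I$ with $\sigma(I)\subset I$; a Hom-Lie algebra is simple if it is not abelian and its only Hom-ideals are $0$ and $A$. *)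

theory Defs
  imports Complex_Main
begin

text \<open>
  The underlying vector space is the whole type \<open>'v\<close>, over the field type \<open>'k\<close>; the algebra
  as a subset of itself is \<open>UNIV\<close> and the zero subspace is \<open>{0}\<close>.
\<close>

locale anticommutative_algebra = vector_space scale
  for scale :: "'k::field \<Rightarrow> 'v::ab_group_add \<Rightarrow> 'v" +
  fixes bracket :: "'v \<Rightarrow> 'v \<Rightarrow> 'v"
  assumes linear_bracket_left: "Vector_Spaces.linear scale scale (\<lambda>x. bracket x y)"
    and linear_bracket_right: "Vector_Spaces.linear scale scale (\<lambda>y. bracket x y)"
    and bracket_self: "bracket x x = 0"
begin

definition abelian :: bool
  where "abelian \<longleftrightarrow> (\<forall>x y. bracket x y = 0)"

definition ideal :: "'v set \<Rightarrow> bool"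
  where "ideal I \<longleftrightarrow> subspace I \<and> (\<forall>x\<in>I. \<forall>y. bracket x y \<in> I)"

end

locale hom_lie_algebra = anticommutative_algebra scale bracket
  for scale :: "'k::field \<Rightarrow> 'v::ab_group_add \<Rightarrow> 'v"
    and bracket :: "'v \<Rightarrow> 'v \<Rightarrow> 'v" +
  fixes \<sigma> :: "'v \<Rightarrow> 'v"
  assumes linear_twist: "Vector_Spaces.linear scale scale \<sigma>"
    and hom_jacobi:
      "bracket (\<sigma> x) (bracket y z) + bracket (\<sigma> y) (bracket z x)
        + bracket (\<sigma> z) (bracket x y) = 0"
begin

definition hom_ideal :: "'v set \<Rightarrow> bool"
  where "hom_ideal I \<longleftrightarrow> ideal I \<and> \<sigma> ` I \<subseteq> I"

definition hom_simple :: bool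
  where "hom_simple \<longleftrightarrow> \<not> abelian \<and> (\<forall>I. hom_ideal I \<longrightarrow> I = {0} \<or> I = UNIV)"

end

locale multiplicative_hom_lie_algebra = hom_lie_algebra scale bracket \<sigma>
  for scale :: "'k::field \<Rightarrow> 'v::ab_group_add \<Rightarrow> 'v"
    and bracket :: "'v \<Rightarrow> 'v \<Rightarrow> 'v"
    and \<sigma> :: "'v \<Rightarrow> 'v" +
  assumes twist_bracket: "\<sigma> (bracket x y) = bracket (\<sigma> x) (\<sigma> y)"

end

theory Submission
  imports Defs
begin

text \<open>
  Suppose the Hom-Lie algebra is simple. The kernel of \<open>\<sigma>\<close> is a Hom-ideal, so either \<open>\<sigma> = 0\<close>,
  in which case every ideal is a Hom-ideal, or \<open>\<sigma>\<close> is an automorphism. In the second case the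
  centre vanishes, and the sum of all minimal ideals, being a nonzero Hom-ideal, is the whole
  algebra. Distinct minimal ideals annihilate each other. If \<open>\<sigma>\<close> moved a minimal ideal \<open>I\<close>, the
  Hom-Jacobi identity for \<open>x \<in> I\<close> and \<open>y, z \<in> J = \<sigma> I\<close> would reduce to \<open>[\<sigma> x, [y, z]] = 0\<close>, so
  \<open>[J, J]\<close> would annihilate every minimal ideal and hence lie in the centre; then \<open>J\<close> itself would
  be central. So \<open>\<sigma>\<close> fixes a minimal ideal, which is therefore the whole algebra.
\<close>

section \<open>Ideals of an anticommutative algebra, without a twist\<close>

context anticommutative_algebra
begin

lemma bracket_add_left: "bracket (x + y) z = bracket x z + bracket y z"
  by (rule module_hom_linearI[OF linear_bracket_left, THEN module_hom.add])

lemma bracket_add_right: "bracket x (y + z) = bracket x y + bracket x z"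
  by (rule module_hom_linearI[OF linear_bracket_right, THEN module_hom.add])

lemma bracket_scale_left: "bracket (scale c x) z = scale c (bracket x z)"
  by (rule module_hom_linearI[OF linear_bracket_left, THEN module_hom.scale])

lemma bracket_scale_right: "bracket x (scale c z) = scale c (bracket x z)"
  by (rule module_hom_linearI[OF linear_bracket_right, THEN module_hom.scale])

lemma bracket_zero_left [simp]: "bracket 0 x = 0"
  using bracket_add_left[of 0 0 x] by simp

lemma bracket_zero_right [simp]: "bracket x 0 = 0"
  using bracket_add_right[of x 0 0] by simp

lemma bracket_anticommute: "bracket x y = - bracket y x"
proof -
  have "bracket (x + y) (x + y) = bracket x y + bracket y x"
    unfolding bracket_add_left bracket_add_right by (simp add: bracket_self)
  then have "bracket x y + bracket y x = 0"
    by (simp only: bracket_self)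
  then show ?thesis
    by (simp only: eq_neg_iff_add_eq_0)
qed

lemma idealD:
  assumes "ideal I"
  shows "subspace I" "x \<in> I \<Longrightarrow> bracket x y \<in> I" "x \<in> I \<Longrightarrow> bracket y x \<in> I"
proof -
  show sub: "subspace I"
    using assms by (simp add: ideal_def)
  show bracket: "bracket x y \<in> I" if "x \<in> I"
    using assms that by (simp add: ideal_def)
  show "bracket y x \<in> I" if "x \<in> I"
    by (subst bracket_anticommute) (rule subspace_neg[OF sub bracket[OF that]])
qed

lemma ideal_Int: "ideal I \<Longrightarrow> ideal J \<Longrightarrow> ideal (I \<inter> J)"
  by (simp add: ideal_def subspace_inter)

text \<open>The span of the union encodes the sum of a family of ideals; since
  \<open>bracket\<close> is linear on the left, closure need only be checked on generators.\<close>

lemma ideal_span_Union: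
  assumes "\<And>I. I \<in> C \<Longrightarrow> ideal I"
  shows "ideal (span (\<Union>C))"
  unfolding ideal_def
proof (intro conjI ballI allI)
  fix x y assume "x \<in> span (\<Union>C)"
  then show "bracket x y \<in> span (\<Union>C)"
  proof (induction rule: span_induct_alt)
    case base
    then show ?case by (simp add: span_zero)
  next
    case (step c x z)
    then have "bracket x y \<in> span (\<Union>C)"
      using assms by (blast intro: span_base idealD)
    with step show ?case
      by (simp add: bracket_add_left bracket_scale_left span_add span_scale)
  qed
qed simp

definition minimal_ideal :: "'v set \<Rightarrow> bool"
  where "minimal_ideal I \<longleftrightarrow> ideal I \<and> I \<noteq> {0} \<and>
    (\<forall>J. ideal J \<longrightarrow> J \<subseteq> I \<longrightarrow> J \<noteq> {0} \<longrightarrow> J = I)"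

text \<open>The bracket lies in both ideals, and a nonzero intersection would be an ideal equal to
  each of them by minimality.\<close>

lemma minimal_ideals_annihilate:
  assumes "minimal_ideal I" "minimal_ideal J" "I \<noteq> J" "x \<in> I" "y \<in> J"
  shows "bracket x y = 0"
proof -
  have "ideal (I \<inter> J)"
    using assms by (simp add: minimal_ideal_def ideal_Int)
  then have "I \<inter> J = {0}"
    using assms unfolding minimal_ideal_def by (metis inf_le1 inf_le2)
  moreover have "bracket x y \<in> I \<inter> J"
    using assms by (auto simp: minimal_ideal_def intro: idealD)
  ultimately show ?thesis by blast
qed

text \<open>A nonzero ideal of least dimension is minimal. \<open>K\<close> only witnesses that
  nonzero ideals exist; the ideal obtained need not lie inside it.\<close>

lemma minimal_ideal_exists:
  assumes "finite_dimensional_vector_space scale Basis" "ideal K" "K \<noteq> {0}"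
  obtains I where "minimal_ideal I"
proof -
  interpret finite_dimensional_vector_space scale Basis by fact
  obtain I where I: "ideal I" "I \<noteq> {0}"
    and least: "\<And>J. ideal J \<Longrightarrow> J \<noteq> {0} \<Longrightarrow> dim I \<le> dim J"
    using ex_has_least_nat[of "\<lambda>I. ideal I \<and> I \<noteq> {0}" K dim] assms by blast
  then have "minimal_ideal I"
    unfolding minimal_ideal_def by (metis idealD(1) subspace_dim_equal)
  then show ?thesis by (rule that)
qed

definition center :: "'v set"
  where "center = {x. \<forall>y. bracket x y = 0}"

lemma ideal_center: "ideal center"
  unfolding ideal_def center_def
  by (auto simp: subspace_def bracket_add_left bracket_scale_left)

lemma annihilates_span:
  assumes "\<And>y. y \<in> S \<Longrightarrow> bracket x y = 0" "y \<in> span S"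
  shows "bracket x y = 0"
  using assms(2)
  by (induction rule: span_induct_alt)
    (simp_all add: bracket_add_right bracket_scale_right assms(1))

end

section \<open>Action of the twist on ideals\<close>

context multiplicative_hom_lie_algebra
begin

lemma twist_add: "\<sigma> (x + y) = \<sigma> x + \<sigma> y"
  by (rule module_hom_linearI[OF linear_twist, THEN module_hom.add])

lemma twist_scale: "\<sigma> (scale c x) = scale c (\<sigma> x)"
  by (rule module_hom_linearI[OF linear_twist, THEN module_hom.scale])

lemma twist_zero [simp]: "\<sigma> 0 = 0"
  using twist_add[of 0 0] by simp

lemma hom_ideal_kernel: "hom_ideal {x. \<sigma> x = 0}"
  unfolding hom_ideal_def ideal_def
  by (auto simp: subspace_def twist_add twist_scale twist_bracket)

text \<open>Surjectivity lets an arbitrary second factor be written as \<open>\<sigma> v\<close>, so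
  that multiplicativity applies.\<close>

lemma ideal_twist_image:
  assumes "surj \<sigma>" "ideal I"
  shows "ideal (\<sigma> ` I)"
  unfolding ideal_def
proof (intro conjI ballI allI)
  show "subspace (\<sigma> ` I)"
    using idealD(1)[OF assms(2)] unfolding subspace_def
    by (auto simp flip: twist_add twist_scale intro: image_eqI[where x=0])
  fix x y assume "x \<in> \<sigma> ` I"
  then obtain u v where "x = \<sigma> u" "u \<in> I" "y = \<sigma> v"
    using assms(1) by (metis imageE surjD)
  then show "bracket x y \<in> \<sigma> ` I"
    using assms(2) by (auto simp flip: twist_bracket intro: idealD)
qed

lemma ideal_twist_vimage: "ideal I \<Longrightarrow> ideal (\<sigma> -` I)"
  by (auto simp: ideal_def subspace_def twist_add twist_scale twist_bracket)

text \<open>A smaller ideal inside the image pulls back along \<open>\<sigma>\<close> to an ideal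
  inside \<open>I\<close>, where minimality decides.\<close>

lemma minimal_ideal_twist_image:
  assumes "bij \<sigma>" "minimal_ideal I"
  shows "minimal_ideal (\<sigma> ` I)"
  unfolding minimal_ideal_def
proof (intro conjI allI impI)
  note surj = bij_is_surj[OF assms(1)] and inj = bij_is_inj[OF assms(1)]
  have I: "ideal I" "I \<noteq> {0}"
    using assms(2) by (auto simp: minimal_ideal_def)
  show "ideal (\<sigma> ` I)"
    by (rule ideal_twist_image[OF surj I(1)])
  show "\<sigma> ` I \<noteq> {0}"
    using I(2) inj by (metis image_empty image_insert inj_image_eq_iff twist_zero)
  fix J assume J: "ideal J" "J \<subseteq> \<sigma> ` I" "J \<noteq> {0}"
  have image: "\<sigma> ` (\<sigma> -` J) = J"
    using surj by (rule surj_image_vimage_eq)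
  have "\<sigma> -` J \<noteq> {0}"
    using J(3) image by force
  moreover have "\<sigma> -` J \<subseteq> I"
    using J(2) inj by (metis image inj_image_subset_iff)
  ultimately have "\<sigma> -` J = I"
    using assms(2) ideal_twist_vimage[OF J(1)] by (simp add: minimal_ideal_def)
  then show "J = \<sigma> ` I"
    using image by simp
qed

lemma hom_ideal_center:
  assumes "surj \<sigma>"
  shows "hom_ideal center"
  unfolding hom_ideal_def
proof (intro conjI subsetI)
  fix x assume "x \<in> \<sigma> ` center"
  then obtain u where u: "x = \<sigma> u" "\<And>y. bracket u y = 0"
    by (auto simp: center_def)
  have "bracket x y = 0" for y
    using surjD[OF assms, of y] u by (metis twist_bracket twist_zero)
  then show "x \<in> center"
    by (simp add: center_def)
qed (rule ideal_center)

lemma hom_ideal_span_minimal_ideals: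
  assumes "bij \<sigma>"
  shows "hom_ideal (span (\<Union>{I. minimal_ideal I}))" (is "hom_ideal (span ?S)")
  unfolding hom_ideal_def
proof (intro conjI image_subsetI)
  show "ideal (span ?S)"
    by (rule ideal_span_Union) (simp add: minimal_ideal_def)
  fix x assume "x \<in> span ?S"
  then show "\<sigma> x \<in> span ?S"
  proof (induction rule: span_induct_alt)
    case base
    then show ?case by (simp add: span_zero)
  next
    case (step c x z)
    then have "\<sigma> x \<in> span ?S"
      using minimal_ideal_twist_image[OF assms] by (blast intro: span_base)
    with step show ?case
      by (simp add: twist_add twist_scale span_add span_scale)
  qed
qed

lemma twist_fixes_minimal_ideal:
  assumes simple: hom_simple and bij: "bij \<sigma>" and I: "minimal_ideal I"
  shows "\<sigma> ` I = I"
proof (rule ccontr)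
  assume moved: "\<sigma> ` I \<noteq> I"
  define J where "J = \<sigma> ` I"
  have J: "minimal_ideal J"
    unfolding J_def by (rule minimal_ideal_twist_image[OF bij I])
  then have zero_J: "ideal J" "J \<noteq> {0}" "0 \<in> J"
    using idealD(1) subspace_0 by (auto simp: minimal_ideal_def)
  have "center \<noteq> UNIV"
    using simple unfolding hom_simple_def abelian_def center_def by blast
  then have center: "center = {0}"
    using simple hom_ideal_center[OF bij_is_surj[OF bij]] unfolding hom_simple_def by blast
  have "J \<subseteq> \<Union>{I. minimal_ideal I}"
    using J by blast
  then have "J \<subseteq> span (\<Union>{I. minimal_ideal I})"
    using span_superset by (rule order_trans)
  then have "span (\<Union>{I. minimal_ideal I}) \<noteq> {0}"
    using zero_J(2,3) by blast
  then have sum: "span (\<Union>{I. minimal_ideal I}) = UNIV"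
    using simple hom_ideal_span_minimal_ideals[OF bij] unfolding hom_simple_def by blast
  \<comment> \<open>Every other minimal ideal annihilates \<open>J\<close> anyway, and the minimal
    ideals span the algebra, so annihilating \<open>J\<close> already means being central.\<close>
  have annihilates_J_eq_0: "x = 0" if x: "x \<in> J" "\<And>y. y \<in> J \<Longrightarrow> bracket x y = 0" for x
  proof -
    have "bracket x y = 0" if y: "y \<in> \<Union>{I. minimal_ideal I}" for y
    proof -
      obtain M where M: "minimal_ideal M" "y \<in> M"
        using y by blast
      show ?thesis
      proof (cases "M = J")
        case True
        with M(2) show ?thesis by (simp add: x(2))
      next
        case False
        with M x(1) show ?thesis by (metis minimal_ideals_annihilate J)
      qed
    qed
    then have "x \<in> center"
      using annihilates_span[of "\<Union>{I. minimal_ideal I}" x] sum by (simp add: center_def)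
    then show "x = 0"
      using center by simp
  qed
  have "bracket y z = 0" if yz: "y \<in> J" "z \<in> J" for y z
  proof (rule annihilates_J_eq_0)
    show "bracket y z \<in> J"
      using zero_J yz by (blast intro: idealD)
    fix w assume "w \<in> J"
    then obtain x where x: "x \<in> I" "w = \<sigma> x"
      by (auto simp: J_def)
    \<comment> \<open>These are the inner brackets of two of the three Hom-Jacobi terms, so only
      \<open>bracket (\<sigma> x) (bracket y z)\<close> survives.\<close>
    have "bracket z x = 0" "bracket x y = 0"
      using minimal_ideals_annihilate[OF I J] minimal_ideals_annihilate[OF J I]
        moved x yz by (auto simp: J_def)
    then have "bracket w (bracket y z) = 0"
      using hom_jacobi[of x y z] x by simp
    then show "bracket (bracket y z) w = 0"
      by (subst bracket_anticommute) simp
  qed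
  \<comment> \<open>Second use of the same criterion: with all brackets inside \<open>J\<close>
    zero, it now applies to the elements of \<open>J\<close> themselves.\<close>
  then have "J \<subseteq> {0}"
    by (auto intro: annihilates_J_eq_0)
  with zero_J show False by blast
qed

lemma hom_simple_imp_no_ideals:
  assumes fd: "finite_dimensional_vector_space scale Basis"
    and simple: hom_simple and K: "ideal K"
  shows "K = {0} \<or> K = UNIV"
proof -
  \<comment> \<open>Simplicity applied to the kernel: the twist is either zero or injective.\<close>
  consider "{x. \<sigma> x = 0} = UNIV" | "{x. \<sigma> x = 0} = {0}"
    using simple hom_ideal_kernel unfolding hom_simple_def by blast
  then show ?thesis
  proof cases
    case 1
    then have "\<sigma> x = 0" for x
      by blast
    then have "\<sigma> ` K \<subseteq> K"
      using subspace_0[OF idealD(1)[OF K]] by auto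
    then show ?thesis
      using simple K unfolding hom_simple_def hom_ideal_def by blast
  next
    case 2
    interpret finite_dimensional_vector_space scale Basis by fact
    interpret twist: Vector_Spaces.linear scale scale \<sigma>
      by (rule linear_twist)
    have "inj \<sigma>"
      using 2 twist.inj_iff_eq_0 by blast
    then have bij: "bij \<sigma>"
      using linear_inj_imp_surj[OF linear_twist] by (simp add: bij_def)
    show ?thesis
    proof (cases "K = {0}")
      case False
      obtain I where I: "minimal_ideal I"
        using minimal_ideal_exists[OF fd K False] .
      then have "hom_ideal I"
        using twist_fixes_minimal_ideal[OF simple bij I]
        by (simp add: hom_ideal_def minimal_ideal_def)
      then have "I = UNIV"
        using I simple unfolding hom_simple_def minimal_ideal_def by blast
      \<comment> \<open>\<open>I\<close> was chosen independently of \<open>K\<close>, but now the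
        whole algebra is a minimal ideal, so the nonzero ideal \<open>K\<close> must equal
        it.\<close>
      then show ?thesis
        using I K unfolding minimal_ideal_def by blast
    qed simp
  qed
qed

end

theorem corollary6p11:
  fixes scale :: "'k::field \<Rightarrow> 'v::ab_group_add \<Rightarrow> 'v"
    and bracket :: "'v \<Rightarrow> 'v \<Rightarrow> 'v"
    and \<sigma> :: "'v \<Rightarrow> 'v"
  assumes "multiplicative_hom_lie_algebra scale bracket \<sigma>"
    and "\<exists>Basis. finite_dimensional_vector_space scale Basis"
  shows "hom_lie_algebra.hom_simple scale bracket \<sigma> \<longleftrightarrow>
    \<not> anticommutative_algebra.abelian bracket \<and>
    (\<forall>I. anticommutative_algebra.ideal scale bracket I \<longrightarrow> I = {0} \<or> I = UNIV)"
proof -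
  interpret multiplicative_hom_lie_algebra scale bracket \<sigma> by fact
  show ?thesis
    \<comment> \<open>The converse direction is immediate, since every Hom-ideal is an
      ideal.\<close>
    using assms(2) hom_simple_imp_no_ideals unfolding hom_simple_def hom_ideal_def by blast
qed

end
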